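(* Let $M_\infty$ be the group of matrices indexed by $\mathbb{Z}\times\mathbb{Z}$, with integer entries, generated by the elementary matrices $m_i$, $i\in\mathbb{Z}$, where $m_i$ has all diagonal entries equal to $1$, the entry at $(i,i+1)$ equal to $1$, and all other entries equal to $0$. Let $G=M_\infty\rtimes\langle\phi\rangle$ be the extension of $M_\infty$ by the infinite cyclic group generated by $\phi$, where $\phi m_i\phi^{-1}=m_{i+1}$ for all $i$. Let $\bar w(x_1,x_2,x_3)=[x_1,[x_2,x_3]]$ and $w'(x_1,x_2,x_3,x_4)=x_4\,\bar w(x_1,x_2,x_3)\,x_4^{-1}$. Then $G$ does not satisfy the iterated identity $w'$.
   Context: Notation: $[u,v]=u^{-1}v^{-1}uv$. For a word $w=w(x_1,\dots,x_n)$ (element of the free group on $x_1,\dots,x_n$), the Engel type iterations on the first variable are $w_{\circ 1}=w$ and $w_{\circ (N+1)}(x_1,\dots,x_n)=w(w_{\circ N}(x_1,\dots,x_n),x_2,\dots,x_n)$ for $N\ge 1$. A group $G$ satisfies the ($E$-type) iterated identity $w$ if for all $x_1,\dots,x_n\in G$ there exists $N\ge 1$ with $w_{\circ N}(x_1,\dots,x_n)=e$ in $G$. *)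

theory Defs
  imports "HOL-Algebra.Algebra"
begin

section \<open>Free groups and words\<close>

text \<open>A letter \<open>(v, True)\<close> is the generator \<open>v\<close>; \<open>(v, False)\<close> is its formal inverse. Elements of
  the free group on \<open>S\<close> are the reduced words over \<open>S\<close>; the product concatenates and cancels.\<close>

type_synonym 'v letters = "('v \<times> bool) list"

definition flip :: "'v \<times> bool \<Rightarrow> 'v \<times> bool" where
  "flip l = (fst l, \<not> snd l)"

definition reduced :: "'v letters \<Rightarrow> bool" where
  "reduced w \<longleftrightarrow> successively (\<lambda>k l. l \<noteq> flip k) w"

fun push :: "'v \<times> bool \<Rightarrow> 'v letters \<Rightarrow> 'v letters" where
  "push l [] = [l]"
| "push l (k # w) = (if k = flip l then w else l # k # w)"

definition free_group :: "'v set \<Rightarrow> 'v letters monoid" where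
  "free_group S =
    \<lparr>carrier = {w. reduced w \<and> fst ` set w \<subseteq> S}, monoid.mult = foldr push, one = []\<rparr>"

definition gen :: "'v \<Rightarrow> 'v letters" where
  "gen v = [(v, True)]"

lemma flip_flip [simp]: "flip (flip l) = l"
  by (simp add: flip_def)

lemma fst_flip [simp]: "fst (flip l) = fst l"
  by (simp add: flip_def)

lemma reduced_Nil [simp]: "reduced []"
  by (simp add: reduced_def)

lemma reduced_push: "reduced w \<Longrightarrow> reduced (push l w)"
  by (cases w) (auto simp: reduced_def successively_Cons)

lemma reduced_Cons_D: "reduced (l # w) \<Longrightarrow> reduced w"
  by (auto simp: reduced_def successively_Cons)

lemma reduced_foldr_push: "reduced v \<Longrightarrow> reduced (foldr push u v)"
  by (induction u) (auto intro: reduced_push)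

lemma push_eq_Cons: "reduced (l # w) \<Longrightarrow> push l w = l # w"
  by (cases w) (auto simp: reduced_def)

lemma push_push_flip: "reduced w \<Longrightarrow> push l (push (flip l) w) = w"
  by (cases w) (auto simp: push_eq_Cons)

lemma set_push: "set (push l w) \<subseteq> insert l (set w)"
  by (cases w) auto

lemma set_foldr_push: "set (foldr push u v) \<subseteq> set u \<union> set v"
proof (induction u)
  case (Cons a u)
  then show ?case using set_push[of a "foldr push u v"] by auto
qed auto

lemma foldr_push_push: "reduced w \<Longrightarrow> foldr push (push l v) w = push l (foldr push v w)"
  by (cases v) (auto simp: push_push_flip reduced_foldr_push)

lemma foldr_push_assoc:
  "reduced w \<Longrightarrow> foldr push (foldr push u v) w = foldr push u (foldr push v w)"
  by (induction u) (auto simp: foldr_push_push)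

lemma foldr_push_Nil: "reduced w \<Longrightarrow> foldr push w [] = w"
  by (induction w) (use push_eq_Cons reduced_Cons_D in force)+

lemma foldr_push_inverse: "foldr push (rev (map flip w)) w = []"
  by (induction w) auto

lemma reduced_rev_flip: "reduced w \<Longrightarrow> reduced (rev (map flip w))"
  unfolding reduced_def successively_rev successively_map
  by (erule successively_mono) (auto simp: flip_def)

lemma group_free_group: "group (free_group S)"
proof (rule groupI)
  fix x y assume "x \<in> carrier (free_group S)" "y \<in> carrier (free_group S)"
  then show "x \<otimes>\<^bsub>free_group S\<^esub> y \<in> carrier (free_group S)"
    using image_mono[OF set_foldr_push[of x y], of fst]
    by (simp add: free_group_def reduced_foldr_push image_Un) blast
next
  fix x assume x: "x \<in> carrier (free_group S)"
  have "rev (map flip x) \<in> carrier (free_group S)"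
    using x reduced_rev_flip[of x] by (auto simp: free_group_def)
  moreover have "rev (map flip x) \<otimes>\<^bsub>free_group S\<^esub> x = \<one>\<^bsub>free_group S\<^esub>"
    using foldr_push_inverse[of x] by (simp add: free_group_def)
  ultimately show "\<exists>y\<in>carrier (free_group S). y \<otimes>\<^bsub>free_group S\<^esub> x = \<one>\<^bsub>free_group S\<^esub>"
    by blast
qed (auto simp: free_group_def foldr_push_assoc)

lemma gen_closed: "v \<in> S \<Longrightarrow> gen v \<in> carrier (free_group S)"
  by (simp add: gen_def free_group_def reduced_def)

text \<open>\<open>word_eval G x w\<close> is the value \<open>w(x)\<close> in \<open>G\<close>. With a free group as \<open>G\<close> it is substitution of
  words into words.\<close>

definition word_eval :: "('a, 'b) monoid_scheme \<Rightarrow> ('v \<Rightarrow> 'a) \<Rightarrow> 'v letters \<Rightarrow> 'a" where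
  "word_eval G x w =
    foldr (\<lambda>(v, b) g. (if b then x v else inv\<^bsub>G\<^esub> (x v)) \<otimes>\<^bsub>G\<^esub> g) w \<one>\<^bsub>G\<^esub>"

lemma (in group) word_eval_closed:
  assumes "x \<in> S \<rightarrow> carrier G" "fst ` set w \<subseteq> S"
  shows "word_eval G x w \<in> carrier G"
  using assms(2)
proof (induction w)
  case (Cons l w)
  then have "x (fst l) \<in> carrier G" using assms(1) by auto
  with Cons show ?case by (auto simp: word_eval_def split: prod.splits)
qed (simp add: word_eval_def)

lemma (in group) word_eval_push:
  assumes "x \<in> S \<rightarrow> carrier G" "fst l \<in> S" "fst ` set w \<subseteq> S"
  shows "word_eval G x (push l w) = word_eval G x [l] \<otimes> word_eval G x w"
proof (cases w)
  case Nil
  then show ?thesis using assms by (cases l) (auto simp: word_eval_def Pi_def)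
next
  case (Cons k w')
  have c: "word_eval G x w' \<in> carrier G" using assms Cons word_eval_closed[of x S w'] by auto
  have d: "x (fst l) \<in> carrier G" "x (fst k) \<in> carrier G" using assms Cons by auto
  show ?thesis
    using c d Cons by (cases l; cases k) (auto simp: word_eval_def flip_def m_assoc[symmetric])
qed

lemma (in group) word_eval_hom:
  assumes x: "x \<in> S \<rightarrow> carrier G"
  shows "word_eval G x \<in> hom (free_group S) G"
proof (rule homI)
  fix u assume "u \<in> carrier (free_group S)"
  then show "word_eval G x u \<in> carrier G"
    using word_eval_closed[OF x] by (auto simp: free_group_def)
next
  fix u v assume u: "u \<in> carrier (free_group S)" and v: "v \<in> carrier (free_group S)"
  have vS: "fst ` set v \<subseteq> S" and "fst ` set u \<subseteq> S" using u v by (auto simp: free_group_def)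
  then have "word_eval G x (foldr push u v) = word_eval G x u \<otimes> word_eval G x v"
  proof (induction u)
    case Nil
    then show ?case using word_eval_closed[OF x vS] by (simp add: word_eval_def)
  next
    case (Cons l u)
    have f: "fst ` set (foldr push u v) \<subseteq> S"
      using Cons.prems set_foldr_push[of u v] by fastforce
    have l: "x (fst l) \<in> carrier G" using Cons.prems x by auto
    have uu: "word_eval G x u \<in> carrier G" using Cons.prems word_eval_closed[OF x] by simp
    have "word_eval G x (foldr push (l # u) v)
        = word_eval G x [l] \<otimes> (word_eval G x u \<otimes> word_eval G x v)"
      using word_eval_push[OF x _ f, of l] Cons by auto
    also have "\<dots> = word_eval G x (l # u) \<otimes> word_eval G x v"
      using l uu word_eval_closed[OF x vS]
      by (cases l) (auto simp: word_eval_def m_assoc)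
    finally show ?case .
  qed
  then show "word_eval G x (u \<otimes>\<^bsub>free_group S\<^esub> v) = word_eval G x u \<otimes> word_eval G x v"
    by (simp add: free_group_def)
qed

lemma (in group) word_eval_gen: "x v \<in> carrier G \<Longrightarrow> word_eval G x (gen v) = x v"
  by (simp add: word_eval_def gen_def)


section \<open>Iterated identities\<close>

text \<open>Words in \<open>n\<close> variables are elements of \<open>free_group {1..n}\<close>, the generator \<open>i\<close> being \<open>x\<^sub>i\<close>.
  \<open>engel_iter n w N\<close> is meant for \<open>N \<ge> 1\<close>.\<close>

definition engel_iter :: "nat \<Rightarrow> nat letters \<Rightarrow> nat \<Rightarrow> nat letters" where
  "engel_iter n w N =
    ((\<lambda>u. word_eval (free_group {1..n}) (gen(1 := u)) w) ^^ (N - 1)) w"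

lemma engel_iter_1: "engel_iter n w 1 = w"
  by (simp add: engel_iter_def)

lemma engel_iter_Suc:
  "N \<ge> 1 \<Longrightarrow> engel_iter n w (N + 1) =
    word_eval (free_group {1..n}) (gen(1 := engel_iter n w N)) w"
  by (cases N) (simp_all add: engel_iter_def)

definition satisfies_iterated_identity ::
    "('a, 'b) monoid_scheme \<Rightarrow> nat \<Rightarrow> nat letters \<Rightarrow> bool" where
  "satisfies_iterated_identity G n w \<longleftrightarrow>
    (\<forall>x \<in> {1..n} \<rightarrow> carrier G. \<exists>N\<ge>1. word_eval G x (engel_iter n w N) = \<one>\<^bsub>G\<^esub>)"

definition commutator :: "('a, 'b) monoid_scheme \<Rightarrow> 'a \<Rightarrow> 'a \<Rightarrow> 'a" where
  "commutator G u v = inv\<^bsub>G\<^esub> u \<otimes>\<^bsub>G\<^esub> inv\<^bsub>G\<^esub> v \<otimes>\<^bsub>G\<^esub> u \<otimes>\<^bsub>G\<^esub> v"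

definition w_bar :: "nat letters" where
  "w_bar = (let F = free_group {1..3} in commutator F (gen 1) (commutator F (gen 2) (gen 3)))"

definition w_prime :: "nat letters" where
  "w_prime = (let F = free_group {1..4} in
    gen 4 \<otimes>\<^bsub>F\<^esub> word_eval F gen w_bar \<otimes>\<^bsub>F\<^esub> inv\<^bsub>F\<^esub> (gen 4))"

lemma (in group) commutator_closed:
  "u \<in> carrier G \<Longrightarrow> v \<in> carrier G \<Longrightarrow> commutator G u v \<in> carrier G"
  by (simp add: commutator_def)

lemma w_bar_closed: "w_bar \<in> carrier (free_group {1..3})"
  unfolding w_bar_def Let_def
  by (intro group.commutator_closed group_free_group gen_closed) auto

lemma w_prime_closed: "w_prime \<in> carrier (free_group {1..4})"
proof -
  interpret F: group "free_group {1..4::nat}" by (rule group_free_group)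
  have "word_eval (free_group {1..4}) gen w_bar \<in> carrier (free_group {1..4})"
    using w_bar_closed by (intro F.word_eval_closed[of _ "{1..3}"] funcsetI gen_closed) (auto simp: free_group_def)
  then show ?thesis
    unfolding w_prime_def Let_def
    by (intro F.m_closed F.inv_closed gen_closed) auto
qed


section \<open>The group of matrices\<close>

text \<open>The ambient group is that of the invertible row-finite matrices, where all the sums in a
  product are finite.\<close>

type_synonym zmatrix = "int \<Rightarrow> int \<Rightarrow> int"

definition row_finite_matrices :: "zmatrix monoid" where
  "row_finite_matrices =
    \<lparr>carrier = {A. \<forall>i. finite {k. A i k \<noteq> 0}},
     monoid.mult = (\<lambda>A B i j. \<Sum>k | A i k \<noteq> 0. A i k * B k j),
     one = (\<lambda>i j. if i = j then 1 else 0)\<rparr>"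

definition m_elem :: "int \<Rightarrow> zmatrix" where
  "m_elem i = (\<lambda>r c. if r = c \<or> (r = i \<and> c = i + 1) then 1 else 0)"

definition M_inf :: "zmatrix monoid" where
  "M_inf = subgroup_generated (units_of row_finite_matrices) (range m_elem)"

lemma mult_superset:
  assumes "finite F" "{k. A i k \<noteq> 0} \<subseteq> F"
  shows "(A \<otimes>\<^bsub>row_finite_matrices\<^esub> B) i j = (\<Sum>k\<in>F. A i k * B k j)"
  unfolding row_finite_matrices_def using assms by (auto intro!: sum.mono_neutral_left)

lemma mult_support:
  "{j. (A \<otimes>\<^bsub>row_finite_matrices\<^esub> B) i j \<noteq> 0} \<subseteq> (\<Union>k\<in>{k. A i k \<noteq> 0}. {j. B k j \<noteq> 0})"
proof
  fix j assume "j \<in> {j. (A \<otimes>\<^bsub>row_finite_matrices\<^esub> B) i j \<noteq> 0}"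
  then have "(\<Sum>k | A i k \<noteq> 0. A i k * B k j) \<noteq> 0" by (simp add: row_finite_matrices_def)
  then obtain k where "A i k \<noteq> 0" "A i k * B k j \<noteq> 0"
    by (metis (mono_tags, lifting) mem_Collect_eq sum.neutral)
  then show "j \<in> (\<Union>k\<in>{k. A i k \<noteq> 0}. {j. B k j \<noteq> 0})" by auto
qed

lemma monoid_row_finite_matrices: "monoid row_finite_matrices"
proof (rule monoidI)
  fix A B assume AB: "A \<in> carrier row_finite_matrices" "B \<in> carrier row_finite_matrices"
  then have "finite (\<Union>k\<in>{k. A i k \<noteq> 0}. {j. B k j \<noteq> 0})" for i
    by (auto simp: row_finite_matrices_def)
  then have "finite {j. (A \<otimes>\<^bsub>row_finite_matrices\<^esub> B) i j \<noteq> 0}" for i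
    using mult_support finite_subset by metis
  then show "A \<otimes>\<^bsub>row_finite_matrices\<^esub> B \<in> carrier row_finite_matrices"
    by (simp add: row_finite_matrices_def)
next
  fix A B C
  assume ABC: "A \<in> carrier row_finite_matrices" "B \<in> carrier row_finite_matrices"
    "C \<in> carrier row_finite_matrices"
  show "A \<otimes>\<^bsub>row_finite_matrices\<^esub> B \<otimes>\<^bsub>row_finite_matrices\<^esub> C =
    A \<otimes>\<^bsub>row_finite_matrices\<^esub> (B \<otimes>\<^bsub>row_finite_matrices\<^esub> C)"
  proof (intro ext)
    fix i j
    define F where "F = {k. A i k \<noteq> 0}"
    define F' where "F' = (\<Union>k\<in>F. {l. B k l \<noteq> 0})"
    have fin: "finite F" "finite F'"
      using ABC by (auto simp: F_def F'_def row_finite_matrices_def)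
    have "((A \<otimes>\<^bsub>row_finite_matrices\<^esub> B) \<otimes>\<^bsub>row_finite_matrices\<^esub> C) i j
        = (\<Sum>l\<in>F'. (A \<otimes>\<^bsub>row_finite_matrices\<^esub> B) i l * C l j)"
      by (rule mult_superset[OF fin(2)]) (use mult_support[of A B i] in \<open>simp add: F'_def F_def\<close>)
    also have "\<dots> = (\<Sum>l\<in>F'. (\<Sum>k\<in>F. A i k * B k l) * C l j)"
      by (subst mult_superset[OF fin(1)]) (auto simp: F_def)
    also have "\<dots> = (\<Sum>k\<in>F. A i k * (\<Sum>l\<in>F'. B k l * C l j))"
      unfolding sum_distrib_left sum_distrib_right mult.assoc by (rule sum.swap)
    also have "\<dots> = (\<Sum>k\<in>F. A i k * (B \<otimes>\<^bsub>row_finite_matrices\<^esub> C) k j)"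
      by (rule sum.cong[OF refl], subst mult_superset[OF fin(2)]) (auto simp: F'_def)
    also have "\<dots> = (A \<otimes>\<^bsub>row_finite_matrices\<^esub> (B \<otimes>\<^bsub>row_finite_matrices\<^esub> C)) i j"
      by (rule mult_superset[OF fin(1), symmetric]) (auto simp: F_def)
    finally show "((A \<otimes>\<^bsub>row_finite_matrices\<^esub> B) \<otimes>\<^bsub>row_finite_matrices\<^esub> C) i j =
      (A \<otimes>\<^bsub>row_finite_matrices\<^esub> (B \<otimes>\<^bsub>row_finite_matrices\<^esub> C)) i j" .
  qed
next
  show "\<one>\<^bsub>row_finite_matrices\<^esub> \<in> carrier row_finite_matrices"
    by (simp add: row_finite_matrices_def)
next
  fix A assume A: "A \<in> carrier row_finite_matrices"
  show "\<one>\<^bsub>row_finite_matrices\<^esub> \<otimes>\<^bsub>row_finite_matrices\<^esub> A = A"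
  proof (intro ext)
    fix i j
    show "(\<one>\<^bsub>row_finite_matrices\<^esub> \<otimes>\<^bsub>row_finite_matrices\<^esub> A) i j = A i j"
      by (subst mult_superset[of "{i}"]) (auto simp: row_finite_matrices_def)
  qed
  show "A \<otimes>\<^bsub>row_finite_matrices\<^esub> \<one>\<^bsub>row_finite_matrices\<^esub> = A"
  proof (intro ext)
    fix i j
    have "finite (insert j {k. A i k \<noteq> 0})" using A by (simp add: row_finite_matrices_def)
    then have "(A \<otimes>\<^bsub>row_finite_matrices\<^esub> \<one>\<^bsub>row_finite_matrices\<^esub>) i j =
        (\<Sum>k\<in>insert j {k. A i k \<noteq> 0}. A i k * \<one>\<^bsub>row_finite_matrices\<^esub> k j)"
      by (rule mult_superset) auto
    also have "\<dots> = (\<Sum>k\<in>insert j {k. A i k \<noteq> 0}. if k = j then A i k else 0)"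
      by (rule sum.cong) (auto simp: row_finite_matrices_def)
    also have "\<dots> = A i j"
      using \<open>finite (insert j {k. A i k \<noteq> 0})\<close> by (subst sum.delta) simp_all
    finally show "(A \<otimes>\<^bsub>row_finite_matrices\<^esub> \<one>\<^bsub>row_finite_matrices\<^esub>) i j = A i j" .
  qed
qed

lemma m_mult_elementary:
  fixes i :: int
  defines "e \<equiv> \<lambda>a r c. if r = c then 1 else if r = i \<and> c = i + 1 then a else 0"
  shows "e a \<otimes>\<^bsub>row_finite_matrices\<^esub> e b = e (a + b)"
proof (intro ext)
  fix r c
  have "(e a \<otimes>\<^bsub>row_finite_matrices\<^esub> e b) r c = (\<Sum>k\<in>{r, r + 1}. e a r k * e b k c)"
    by (rule mult_superset) (auto simp: e_def split: if_splits)
  also have "\<dots> = e a r r * e b r c + e a r (r + 1) * e b (r + 1) c"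
    by simp
  also have "\<dots> = e (a + b) r c"
    by (simp add: e_def)
  finally show "(e a \<otimes>\<^bsub>row_finite_matrices\<^esub> e b) r c = e (a + b) r c" .
qed

lemma m_Units: "m_elem i \<in> Units row_finite_matrices"
proof -
  define e where "e = (\<lambda>(a::int) r c. if r = c then 1 else if r = i \<and> c = i + 1 then a else 0)"
  have c: "e a \<in> carrier row_finite_matrices" for a
  proof -
    have "finite {k. e a r k \<noteq> 0}" for r
      by (rule finite_subset[of _ "{r, i + 1}"]) (auto simp: e_def split: if_splits)
    then show ?thesis by (simp add: row_finite_matrices_def)
  qed
  have "e a \<otimes>\<^bsub>row_finite_matrices\<^esub> e b = e (a + b)" for a b
    unfolding e_def by (rule m_mult_elementary)
  moreover have "e 0 = \<one>\<^bsub>row_finite_matrices\<^esub>"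
    by (auto simp: e_def row_finite_matrices_def fun_eq_iff)
  moreover have "m_elem i = e 1" by (auto simp: m_elem_def e_def fun_eq_iff)
  ultimately show ?thesis
    unfolding Units_def using c by (auto intro!: bexI[of _ "e (-1)"])
qed

lemma group_units_row_finite: "group (units_of row_finite_matrices)"
  by (rule monoid.units_group[OF monoid_row_finite_matrices])

lemma carrier_M_inf: "carrier M_inf = generate (units_of row_finite_matrices) (range m_elem)"
proof -
  have "carrier (units_of row_finite_matrices) \<inter> range m_elem = range m_elem"
    using m_Units by (auto simp: units_of_def)
  then show ?thesis by (simp add: M_inf_def carrier_subgroup_generated)
qed

lemma group_M_inf: "group M_inf"
  unfolding M_inf_def by (rule group.group_subgroup_generated[OF group_units_row_finite])

lemma m_in_M_inf: "m_elem i \<in> carrier M_inf"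
  by (simp add: carrier_M_inf generate.incl)

lemma mult_M_inf: "monoid.mult M_inf = monoid.mult row_finite_matrices"
  by (simp add: M_inf_def subgroup_generated_def units_of_def)


section \<open>The extension by a cyclic group\<close>

text \<open>The semidirect product of \<open>N\<close> by \<open>H\<close> for an action \<open>\<theta>\<close> of \<open>H\<close> on \<open>N\<close> by automorphisms,
  so that \<open>(\<one>, h) (a, \<one>) (\<one>, h)\<inverse> = (\<theta> h a, \<one>)\<close>.\<close>

definition semidirect_product ::
    "('a, 'c) monoid_scheme \<Rightarrow> ('b, 'd) monoid_scheme \<Rightarrow> ('b \<Rightarrow> 'a \<Rightarrow> 'a) \<Rightarrow> ('a \<times> 'b) monoid" where
  "semidirect_product N H \<theta> =
    \<lparr>carrier = carrier N \<times> carrier H,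
     monoid.mult = (\<lambda>(a, h) (b, k). (a \<otimes>\<^bsub>N\<^esub> \<theta> h b, h \<otimes>\<^bsub>H\<^esub> k)),
     one = (\<one>\<^bsub>N\<^esub>, \<one>\<^bsub>H\<^esub>)\<rparr>"

lemma group_semidirect_product:
  assumes "group N" "group H"
    and hom: "\<And>h. h \<in> carrier H \<Longrightarrow> \<theta> h \<in> hom N N"
    and one: "\<And>a. a \<in> carrier N \<Longrightarrow> \<theta> \<one>\<^bsub>H\<^esub> a = a"
    and mult: "\<And>h k a. h \<in> carrier H \<Longrightarrow> k \<in> carrier H \<Longrightarrow> a \<in> carrier N \<Longrightarrow>
      \<theta> (h \<otimes>\<^bsub>H\<^esub> k) a = \<theta> h (\<theta> k a)"
  shows "group (semidirect_product N H \<theta>)"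
proof -
  interpret N: group N by fact
  interpret H: group H by fact
  have cl: "\<theta> h a \<in> carrier N" if "h \<in> carrier H" "a \<in> carrier N" for h a
    using hom that by (auto simp: hom_def)
  have hm: "\<theta> h (a \<otimes>\<^bsub>N\<^esub> b) = \<theta> h a \<otimes>\<^bsub>N\<^esub> \<theta> h b"
    if "h \<in> carrier H" "a \<in> carrier N" "b \<in> carrier N" for h a b
    using hom that by (auto simp: hom_def)
  show ?thesis
  proof (rule groupI)
    fix x assume "x \<in> carrier (semidirect_product N H \<theta>)"
    then obtain a h where x: "x = (a, h)" "a \<in> carrier N" "h \<in> carrier H"
      by (auto simp: semidirect_product_def)
    let ?y = "(\<theta> (inv\<^bsub>H\<^esub> h) (inv\<^bsub>N\<^esub> a), inv\<^bsub>H\<^esub> h)"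
    have "?y \<in> carrier (semidirect_product N H \<theta>)"
      using x cl by (simp add: semidirect_product_def)
    moreover have "\<theta> (inv\<^bsub>H\<^esub> h) (inv\<^bsub>N\<^esub> a) \<otimes>\<^bsub>N\<^esub> \<theta> (inv\<^bsub>H\<^esub> h) a = \<one>\<^bsub>N\<^esub>"
    proof -
      have "\<theta> (inv\<^bsub>H\<^esub> h) \<one>\<^bsub>N\<^esub> = \<one>\<^bsub>N\<^esub>"
        by (rule hom_one[OF hom \<open>group N\<close> \<open>group N\<close>]) (use x in simp)
      then show ?thesis
        using x hm[of "inv\<^bsub>H\<^esub> h" "inv\<^bsub>N\<^esub> a" a] by simp
    qed
    then have "?y \<otimes>\<^bsub>semidirect_product N H \<theta>\<^esub> x = \<one>\<^bsub>semidirect_product N H \<theta>\<^esub>"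
      using x by (simp add: semidirect_product_def)
    ultimately show "\<exists>y\<in>carrier (semidirect_product N H \<theta>).
        y \<otimes>\<^bsub>semidirect_product N H \<theta>\<^esub> x = \<one>\<^bsub>semidirect_product N H \<theta>\<^esub>"
      by blast
  qed (auto simp: semidirect_product_def cl hm one mult N.m_assoc H.m_assoc)
qed

definition shift :: "int \<Rightarrow> zmatrix \<Rightarrow> zmatrix" where
  "shift s A = (\<lambda>i j. A (i - s) (j - s))"

definition G_ext :: "(zmatrix \<times> int) monoid" where
  "G_ext = semidirect_product M_inf integer_group shift"

definition phi :: "zmatrix \<times> int" where
  "phi = (\<one>\<^bsub>M_inf\<^esub>, 1)"

lemma shift_m: "shift s (m_elem i) = m_elem (i + s)"
  by (auto simp: shift_def m_elem_def fun_eq_iff)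

lemma shift_shift: "shift s (shift t A) = shift (s + t) A"
  by (simp add: shift_def fun_eq_iff algebra_simps)

lemma shift_0 [simp]: "shift 0 A = A"
  by (simp add: shift_def)

lemma shift_one: "shift s \<one>\<^bsub>row_finite_matrices\<^esub> = \<one>\<^bsub>row_finite_matrices\<^esub>"
  by (auto simp: shift_def row_finite_matrices_def fun_eq_iff)

lemma shift_mult:
  "shift s (A \<otimes>\<^bsub>row_finite_matrices\<^esub> B) = shift s A \<otimes>\<^bsub>row_finite_matrices\<^esub> shift s B"
proof (intro ext)
  fix i j
  have "(\<Sum>k | A (i - s) k \<noteq> 0. A (i - s) k * B k (j - s)) =
      (\<Sum>k | A (i - s) (k - s) \<noteq> 0. A (i - s) (k - s) * B (k - s) (j - s))"
    by (rule sum.reindex_bij_witness[of _ "\<lambda>k. k - s" "\<lambda>k. k + s"]) auto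
  then show "shift s (A \<otimes>\<^bsub>row_finite_matrices\<^esub> B) i j =
      (shift s A \<otimes>\<^bsub>row_finite_matrices\<^esub> shift s B) i j"
    by (simp add: shift_def row_finite_matrices_def)
qed

lemma shift_closed:
  assumes "A \<in> carrier row_finite_matrices"
  shows "shift s A \<in> carrier row_finite_matrices"
proof -
  have "finite {k. A (i - s) (k - s) \<noteq> 0}" for i
  proof (rule finite_subset)
    show "{k. A (i - s) (k - s) \<noteq> 0} \<subseteq> (\<lambda>k. k + s) ` {k. A (i - s) k \<noteq> 0}"
      by (rule subsetI, rule image_eqI[of _ _ "_ - s"]) simp_all
    show "finite ((\<lambda>k. k + s) ` {k. A (i - s) k \<noteq> 0})"
      using assms by (simp add: row_finite_matrices_def)
  qed
  then show ?thesis by (simp add: row_finite_matrices_def shift_def)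
qed

lemma shift_hom_units: "shift s \<in> hom (units_of row_finite_matrices) (units_of row_finite_matrices)"
proof (rule homI)
  fix A assume "A \<in> carrier (units_of row_finite_matrices)"
  then obtain B where "A \<in> carrier row_finite_matrices" "B \<in> carrier row_finite_matrices"
    "B \<otimes>\<^bsub>row_finite_matrices\<^esub> A = \<one>\<^bsub>row_finite_matrices\<^esub>"
    "A \<otimes>\<^bsub>row_finite_matrices\<^esub> B = \<one>\<^bsub>row_finite_matrices\<^esub>"
    by (auto simp: units_of_def Units_def)
  then show "shift s A \<in> carrier (units_of row_finite_matrices)"
    unfolding units_of_def Units_def
    by (auto simp: shift_closed shift_mult[symmetric] shift_one intro!: bexI[of _ "shift s B"])
qed (simp add: units_of_def shift_mult)

lemma shift_hom: "shift s \<in> hom M_inf M_inf"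
proof (rule homI)
  interpret h: group_hom "units_of row_finite_matrices" "units_of row_finite_matrices" "shift s"
    by (intro group_hom.intro group_hom_axioms.intro group_units_row_finite shift_hom_units)
  have "shift s ` generate (units_of row_finite_matrices) (range m_elem) =
      generate (units_of row_finite_matrices) (shift s ` range m_elem)"
    by (rule h.generate_img[symmetric]) (use m_Units in \<open>auto simp: units_of_def\<close>)
  also have "\<dots> \<subseteq> generate (units_of row_finite_matrices) (range m_elem)"
    by (rule h.mono_generate) (auto simp: shift_m)
  finally show "shift s A \<in> carrier M_inf" if "A \<in> carrier M_inf" for A
    using that by (auto simp: carrier_M_inf)
qed (simp add: mult_M_inf shift_mult)

lemma group_G_ext: "group G_ext"
  unfolding G_ext_def
  by (rule group_semidirect_product)
    (simp_all add: group_M_inf shift_hom shift_shift)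

lemma phi_closed: "phi \<in> carrier G_ext"
  using group.is_monoid[OF group_M_inf]
  by (simp add: phi_def G_ext_def semidirect_product_def integer_group_def monoid.one_closed)

lemma phi_conj_m:
  "phi \<otimes>\<^bsub>G_ext\<^esub> (m_elem i, 0) \<otimes>\<^bsub>G_ext\<^esub> inv\<^bsub>G_ext\<^esub> phi = (m_elem (i + 1), 0)"
proof -
  interpret G: group G_ext by (rule group_G_ext)
  interpret M: group M_inf by (rule group_M_inf)
  have m: "(m_elem j, 0) \<in> carrier G_ext" for j
    by (simp add: G_ext_def semidirect_product_def integer_group_def m_in_M_inf)
  have "shift 0 \<one>\<^bsub>M_inf\<^esub> = \<one>\<^bsub>M_inf\<^esub>" by simp
  then have "phi \<otimes>\<^bsub>G_ext\<^esub> (m_elem i, 0) = (m_elem (i + 1), 0) \<otimes>\<^bsub>G_ext\<^esub> phi"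
    by (simp add: phi_def G_ext_def semidirect_product_def integer_group_def shift_m m_in_M_inf)
  then show ?thesis using m phi_closed by (simp add: G.m_assoc)
qed

end

(* Write T(i,j) for the elementary matrix with an extra 1 at (i,j). Take x1 = m_0, x2 = m_1,
   x3 = m_2 and x4 = phi^(-2). Then [x2,x3] = T(1,3), and [T(i,1), T(1,3)] = T(i,3) for i < 1,
   which x4 conjugates to T(i-2,1). So the N-th iterate takes the value T(-2N,1), never trivial. *)

theory Submission
  imports Defs
begin

section \<open>Evaluation of words\<close>

text \<open>Evaluation at \<open>x\<close> is a homomorphism on the free group, so it passes through
  a substitution letter by letter. This turns an iteration of words into an iteration of elements of
  the group.\<close>

lemma (in group) word_eval_word_eval:
  assumes x: "x \<in> S \<rightarrow> carrier G" and \<sigma>: "\<sigma> \<in> V \<rightarrow> carrier (free_group S)"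
    and w: "fst ` set w \<subseteq> V"
  shows "word_eval G x (word_eval (free_group S) \<sigma> w) = word_eval G (\<lambda>v. word_eval G x (\<sigma> v)) w"
proof -
  interpret F: group "free_group S" by (rule group_free_group)
  interpret h: group_hom "free_group S" G "word_eval G x"
    by (intro group_hom.intro group_hom_axioms.intro group_axioms F.group_axioms word_eval_hom x)
  show ?thesis
    using w
  proof (induction w)
    case Nil
    then show ?case using h.hom_one by (simp add: word_eval_def)
  next
    case (Cons l w)
    obtain v b where l: "l = (v, b)" by (cases l)
    have v: "\<sigma> v \<in> carrier (free_group S)" using Cons.prems \<sigma> l by auto
    have "word_eval (free_group S) \<sigma> w \<in> carrier (free_group S)"
      using Cons.prems by (intro F.word_eval_closed[OF \<sigma>]) auto
    then have "word_eval G x ((if b then \<sigma> v else inv\<^bsub>free_group S\<^esub> (\<sigma> v))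
          \<otimes>\<^bsub>free_group S\<^esub> word_eval (free_group S) \<sigma> w)
        = (if b then word_eval G x (\<sigma> v) else inv (word_eval G x (\<sigma> v)))
          \<otimes> word_eval G (\<lambda>v. word_eval G x (\<sigma> v)) w"
      using v Cons by simp
    then show ?case by (simp add: l word_eval_def)
  qed
qed

text \<open>\<open>word_eval_gen\<close> gives \<open>word_eval G x (gen v) = x v\<close> only where
  \<open>x v\<close> lies in the carrier. The assignments compared below are therefore known to
  agree only on the variables of the word, not as functions.\<close>

lemma word_eval_cong:
  assumes "\<And>v. v \<in> fst ` set w \<Longrightarrow> x v = y v"
  shows "word_eval G x w = word_eval G y w"
  using assms by (induction w) (auto simp: word_eval_def split: prod.splits)

lemma (in group_hom) hom_commutator:
  assumes "u \<in> carrier G" "v \<in> carrier G"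
  shows "h (commutator G u v) = commutator H (h u) (h v)"
  using assms by (simp add: commutator_def)

lemma (in group) word_eval_w_bar:
  assumes "x \<in> {1..3} \<rightarrow> carrier G"
  shows "word_eval G x w_bar = commutator G (x 1) (commutator G (x 2) (x 3))"
proof -
  interpret F: group "free_group {1..3::nat}" by (rule group_free_group)
  interpret h: group_hom "free_group {1..3}" G "word_eval G x"
    by (intro group_hom.intro group_hom_axioms.intro group_axioms F.group_axioms word_eval_hom assms)
  show ?thesis
    using assms unfolding w_bar_def Let_def
    by (simp add: h.hom_commutator F.commutator_closed gen_closed word_eval_gen Pi_def
        del: One_nat_def)
qed

text \<open>\<open>w_prime\<close> embeds \<open>w_bar\<close> from the free group on three
  generators into the one on four by evaluating it at \<open>gen\<close>; composing this with
  evaluation at \<open>x\<close> is again evaluation at \<open>x\<close>.\<close>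

lemma (in group) word_eval_w_prime:
  assumes "x \<in> {1..4} \<rightarrow> carrier G"
  shows "word_eval G x w_prime
    = x 4 \<otimes> commutator G (x 1) (commutator G (x 2) (x 3)) \<otimes> inv (x 4)"
proof -
  interpret F: group "free_group {1..4::nat}" by (rule group_free_group)
  interpret h: group_hom "free_group {1..4}" G "word_eval G x"
    by (intro group_hom.intro group_hom_axioms.intro group_axioms F.group_axioms word_eval_hom assms)
  have w: "fst ` set w_bar \<subseteq> {1..3}"
    using w_bar_closed by (auto simp: free_group_def)
  have gens: "gen \<in> {1..3} \<rightarrow> carrier (free_group {1..4::nat})"
    by (auto intro!: gen_closed)
  have "word_eval G x (word_eval (free_group {1..4}) gen w_bar)
      = word_eval G (\<lambda>v. word_eval G x (gen v)) w_bar"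
    by (rule word_eval_word_eval[OF assms gens w])
  also have "\<dots> = word_eval G x w_bar"
    using assms w by (intro word_eval_cong word_eval_gen) force
  also have "\<dots> = commutator G (x 1) (commutator G (x 2) (x 3))"
    using assms by (intro word_eval_w_bar) (auto simp: Pi_def)
  finally have "word_eval G x (word_eval (free_group {1..4}) gen w_bar)
      = commutator G (x 1) (commutator G (x 2) (x 3))" .
  then show ?thesis
    using assms F.word_eval_closed[OF gens w] unfolding w_prime_def Let_def
    by (simp add: gen_closed word_eval_gen Pi_def del: One_nat_def)
qed

lemma engel_iter_closed:
  assumes "w \<in> carrier (free_group {1..n})"
  shows "engel_iter n w N \<in> carrier (free_group {1..n})"
proof -
  interpret F: group "free_group {1..n}" by (rule group_free_group)
  have w: "fst ` set w \<subseteq> {1..n}" using assms by (auto simp: free_group_def)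
  define f where "f u = word_eval (free_group {1..n}) (gen(1 := u)) w" for u
  have "(f ^^ k) w \<in> carrier (free_group {1..n})" for k
  proof (induction k)
    case (Suc k)
    have "f u \<in> carrier (free_group {1..n})" if "u \<in> carrier (free_group {1..n})" for u
      unfolding f_def using that
      by (intro F.word_eval_closed[OF _ w]) (auto intro!: gen_closed simp del: One_nat_def)
    with Suc show ?case by simp
  qed (use assms in simp)
  then show ?thesis by (simp add: engel_iter_def f_def[abs_def])
qed

text \<open>With the other variables fixed, the values of the iterates form an orbit of the self-map
  of G that sends g to the value of \<open>w\<close> with g in the first place. Only this one map
  has to be followed.\<close>

lemma (in group) word_eval_engel_iter_Suc:
  assumes x: "x \<in> {1..n} \<rightarrow> carrier G" and w: "w \<in> carrier (free_group {1..n})" and "N \<ge> 1"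
  shows "word_eval G x (engel_iter n w (N + 1))
    = word_eval G (x(1 := word_eval G x (engel_iter n w N))) w"
proof -
  have w': "fst ` set w \<subseteq> {1..n}" using w by (auto simp: free_group_def)
  have "gen(1 := engel_iter n w N) \<in> {1..n} \<rightarrow> carrier (free_group {1..n})"
    using engel_iter_closed[OF w] by (auto intro!: gen_closed simp del: One_nat_def)
  then have "word_eval G x (engel_iter n w (N + 1))
      = word_eval G (\<lambda>v. word_eval G x ((gen(1 := engel_iter n w N)) v)) w"
    unfolding engel_iter_Suc[OF \<open>N \<ge> 1\<close>] by (rule word_eval_word_eval[OF x _ w'])
  also have "\<dots> = word_eval G (x(1 := word_eval G x (engel_iter n w N))) w"
    using x w' by (intro word_eval_cong) (force simp: word_eval_gen)
  finally show ?thesis .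
qed

text \<open>Since [u,v] = (vu)^(-1) uv, a commutator can be found from an equation free of inverses,
  so no inverse matrix ever has to be written down.\<close>

lemma (in group) commutator_eqI:
  assumes "u \<in> carrier G" "v \<in> carrier G" "z \<in> carrier G"
    and "u \<otimes> v = v \<otimes> u \<otimes> z"
  shows "commutator G u v = z"
proof -
  have "commutator G u v = inv (v \<otimes> u) \<otimes> (u \<otimes> v)"
    using assms(1-3) by (simp add: commutator_def inv_mult_group m_assoc)
  also have "\<dots> = z"
    using assms by (intro inv_solve_left[THEN iffD2, symmetric]) simp_all
  finally show ?thesis .
qed


section \<open>Elementary matrices\<close>

text \<open>Commutators of the \<open>m_elem i\<close> leave the superdiagonal, so the extra entry
  is allowed at any position.\<close>

definition transvection :: "int \<Rightarrow> int \<Rightarrow> zmatrix" where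
  "transvection i j = (\<lambda>r c. if r = c \<or> (r = i \<and> c = j) then 1 else 0)"

lemma m_elem_eq_transvection: "m_elem i = transvection i (i + 1)"
  by (simp add: m_elem_def transvection_def)

lemma shift_transvection: "shift s (transvection i j) = transvection (i + s) (j + s)"
  by (auto simp: shift_def transvection_def fun_eq_iff)

lemma transvection_closed: "transvection i j \<in> carrier row_finite_matrices"
proof -
  have "finite {k. transvection i j r k \<noteq> 0}" for r
    by (rule finite_subset[of _ "{r, j}"]) (auto simp: transvection_def split: if_splits)
  then show ?thesis by (simp add: row_finite_matrices_def)
qed

text \<open>Left multiplication is a row operation: row j is added to row i.\<close>

lemma transvection_mult:
  assumes "i \<noteq> j"
  shows "(transvection i j \<otimes>\<^bsub>row_finite_matrices\<^esub> B) r c = B r c + (if r = i then B j c else 0)"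
proof (cases "r = i")
  case True
  have "(transvection i j \<otimes>\<^bsub>row_finite_matrices\<^esub> B) r c
      = (\<Sum>k\<in>{i, j}. transvection i j r k * B k c)"
    by (rule mult_superset) (auto simp: True transvection_def split: if_splits)
  then show ?thesis using assms by (simp add: True transvection_def)
next
  case False
  have "(transvection i j \<otimes>\<^bsub>row_finite_matrices\<^esub> B) r c
      = (\<Sum>k\<in>{r}. transvection i j r k * B k c)"
    by (rule mult_superset) (auto simp: False transvection_def split: if_splits)
  then show ?thesis by (simp add: False transvection_def)
qed

lemma transvection_commutation:
  assumes "i < j" "j < k"
  shows "transvection i j \<otimes>\<^bsub>M_inf\<^esub> transvection j k
    = transvection j k \<otimes>\<^bsub>M_inf\<^esub> transvection i j \<otimes>\<^bsub>M_inf\<^esub> transvection i k"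
proof -
  interpret R: monoid row_finite_matrices by (rule monoid_row_finite_matrices)
  \<comment> \<open>Bracketing to the right makes every left factor a transvection, so both sides
    unfold into row operations.\<close>
  have "transvection i j \<otimes>\<^bsub>row_finite_matrices\<^esub> transvection j k
      = transvection j k \<otimes>\<^bsub>row_finite_matrices\<^esub>
        (transvection i j \<otimes>\<^bsub>row_finite_matrices\<^esub> transvection i k)"
    using assms by (intro ext) (auto simp: transvection_mult, auto simp: transvection_def)
  then show ?thesis by (simp add: mult_M_inf R.m_assoc transvection_closed)
qed

lemma one_M_inf: "\<one>\<^bsub>M_inf\<^esub> = \<one>\<^bsub>row_finite_matrices\<^esub>"
  by (simp add: M_inf_def subgroup_generated_def units_of_def)

lemma carrier_M_inf_subset: "carrier M_inf \<subseteq> carrier row_finite_matrices"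
proof -
  have "carrier M_inf \<subseteq> carrier (units_of row_finite_matrices)"
    unfolding M_inf_def by (rule group.carrier_subgroup_generated_subset[OF group_units_row_finite])
  then show ?thesis by (auto simp: units_of_def Units_def)
qed

text \<open>Induction on the column: T(i,j+1) is the commutator of T(i,j) and the generator
  T(j,j+1).\<close>

lemma transvection_in_M_inf:
  assumes "i < j"
  shows "transvection i j \<in> carrier M_inf"
  using assms
proof (induction j rule: int_gr_induct)
  case base
  then show ?case using m_in_M_inf[of i] by (simp add: m_elem_eq_transvection)
next
  case (step j)
  interpret M: group M_inf by (rule group_M_inf)
  interpret R: monoid row_finite_matrices by (rule monoid_row_finite_matrices)
  let ?u = "transvection i j" and ?v = "transvection j (j + 1)" and ?z = "transvection i (j + 1)"
  have v: "?v \<in> carrier M_inf" using m_in_M_inf[of j] by (simp add: m_elem_eq_transvection)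
  let ?g = "?v \<otimes>\<^bsub>M_inf\<^esub> ?u"
  have g: "?g \<in> carrier M_inf" "inv\<^bsub>M_inf\<^esub> ?g \<in> carrier M_inf" using v step.IH by auto
  \<comment> \<open>Membership of \<open>?z\<close> is still to be shown, so the group laws of
    \<open>M_inf\<close> do not apply to it. The cancellation uses the monoid of row-finite
    matrices, which has the same product and unit.\<close>
  have "?z = (inv\<^bsub>M_inf\<^esub> ?g \<otimes>\<^bsub>M_inf\<^esub> ?g) \<otimes>\<^bsub>M_inf\<^esub> ?z"
    unfolding M.l_inv[OF g(1)] by (simp add: mult_M_inf one_M_inf transvection_closed)
  also have "\<dots> = inv\<^bsub>M_inf\<^esub> ?g \<otimes>\<^bsub>M_inf\<^esub> (?g \<otimes>\<^bsub>M_inf\<^esub> ?z)"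
    using g carrier_M_inf_subset unfolding mult_M_inf
    by (intro R.m_assoc transvection_closed) auto
  also have "\<dots> = inv\<^bsub>M_inf\<^esub> ?g \<otimes>\<^bsub>M_inf\<^esub> (?u \<otimes>\<^bsub>M_inf\<^esub> ?v)"
    using transvection_commutation[of i j "j + 1"] step.hyps by simp
  also have "\<dots> \<in> carrier M_inf" using g v step.IH by simp
  finally show ?case .
qed


section \<open>The extension\<close>

lemma carrier_G_ext: "(A, s) \<in> carrier G_ext \<longleftrightarrow> A \<in> carrier M_inf"
  by (simp add: G_ext_def semidirect_product_def integer_group_def)

lemma mult_G_ext: "(A, s) \<otimes>\<^bsub>G_ext\<^esub> (B, t) = (A \<otimes>\<^bsub>M_inf\<^esub> shift s B, s + t)"
  by (simp add: G_ext_def semidirect_product_def integer_group_def)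

lemma one_G_ext: "\<one>\<^bsub>G_ext\<^esub> = (\<one>\<^bsub>M_inf\<^esub>, 0)"
  by (simp add: G_ext_def semidirect_product_def integer_group_def)

text \<open>Both elements have second component 0, so the action is trivial and the relation in
  \<open>M_inf\<close> carries over.\<close>

lemma commutator_transvection:
  assumes "i < j" "j < k"
  shows "commutator G_ext (transvection i j, 0) (transvection j k, 0) = (transvection i k, 0)"
  using assms
  by (intro group.commutator_eqI[OF group_G_ext])
    (simp_all add: carrier_G_ext mult_G_ext transvection_in_M_inf transvection_commutation)

lemma conj_transvection:
  assumes "i < j"
  shows "(\<one>\<^bsub>M_inf\<^esub>, s) \<otimes>\<^bsub>G_ext\<^esub> (transvection i j, 0) \<otimes>\<^bsub>G_ext\<^esub> inv\<^bsub>G_ext\<^esub> (\<one>\<^bsub>M_inf\<^esub>, s)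
    = (transvection (i + s) (j + s), 0)"
proof -
  interpret G: group G_ext by (rule group_G_ext)
  interpret M: group M_inf by (rule group_M_inf)
  \<comment> \<open>Moving the cyclic factor past a matrix shifts the matrix, so its inverse is
    cancelled rather than computed.\<close>
  have "(\<one>\<^bsub>M_inf\<^esub>, s) \<otimes>\<^bsub>G_ext\<^esub> (transvection i j, 0)
      = (transvection (i + s) (j + s), 0) \<otimes>\<^bsub>G_ext\<^esub> (\<one>\<^bsub>M_inf\<^esub>, s)"
    using assms by (simp add: mult_G_ext shift_transvection transvection_in_M_inf)
  then show ?thesis
    using assms by (simp add: G.m_assoc carrier_G_ext transvection_in_M_inf)
qed

lemma transvection_neq_one: "i \<noteq> j \<Longrightarrow> transvection i j \<noteq> \<one>\<^bsub>M_inf\<^esub>"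
  by (auto simp: one_M_inf row_finite_matrices_def transvection_def fun_eq_iff)

theorem mainTheorem7:
  shows "\<not> satisfies_iterated_identity G_ext 4 w_prime"
proof -
  interpret G: group G_ext by (rule group_G_ext)
  interpret M: group M_inf by (rule group_M_inf)
  \<comment> \<open>The first clause is phi^(-2); at v = 1, 2, 3 the second gives m_0, m_1, m_2. The
    exponent -2 is forced by [x2,x3] = T(1,3): column 3 has to return to column 1 for the next
    commutator to have the same shape.\<close>
  define x :: "nat \<Rightarrow> zmatrix \<times> int"
    where "x v = (if v = 4 then (\<one>\<^bsub>M_inf\<^esub>, -2) else (transvection (int v - 1) (int v), 0))"
    for v
  have x: "x \<in> {1..4} \<rightarrow> carrier G_ext"
    by (auto simp: x_def carrier_G_ext transvection_in_M_inf)
  \<comment> \<open>The condition i < 1 is inherited by i - 2, so the step can be repeated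
    forever.\<close>
  have step: "word_eval G_ext (x(1 := (transvection i 1, 0))) w_prime = (transvection (i - 2) 1, 0)"
    if "i < 1" for i
  proof -
    have x': "x(1 := (transvection i 1, 0)) \<in> {1..4} \<rightarrow> carrier G_ext"
      using x that by (auto simp: carrier_G_ext transvection_in_M_inf)
    show ?thesis
      unfolding G.word_eval_w_prime[OF x']
      using that by (simp add: x_def commutator_transvection conj_transvection)
  qed
  \<comment> \<open>Iterates are counted from 1, so \<open>Suc n\<close> stands for N and the row
    index -2N becomes -2n-2.\<close>
  have "word_eval G_ext x (engel_iter 4 w_prime (Suc n)) = (transvection (- 2 * int n - 2) 1, 0)"
    for n
  proof (induction n)
    case 0
    \<comment> \<open>The starting value m_0 = T(0,1) already has the form T(i,1), so the first
      iterate is an instance of \<open>step\<close> as well.\<close>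
    have "x = x(1 := (transvection 0 1, 0))" by (simp add: x_def fun_eq_iff)
    then have "word_eval G_ext x w_prime = (transvection (- 2) 1, 0)"
      using step[of 0] by simp
    then show ?case using engel_iter_1[of 4 w_prime] by simp
  next
    case (Suc n)
    then show ?case
      using G.word_eval_engel_iter_Suc[OF x w_prime_closed, of "Suc n"]
        step[of "- 2 * int n - 2"]
      by simp
  qed
  \<comment> \<open>The row index is negative and the column index is 1, so the extra entry lies off
    the diagonal.\<close>
  then have "word_eval G_ext x (engel_iter 4 w_prime N) \<noteq> \<one>\<^bsub>G_ext\<^esub>" if "N \<ge> 1" for N
    using that by (cases N) (simp_all add: one_G_ext transvection_neq_one)
  then show ?thesis using x unfolding satisfies_iterated_identity_def by blast
qed

end
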